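(* Let $\alpha:[0,1]\to\mathcal{E}(S,\mathcal{T})_1$ be a continuous path, and set $\alpha(t)=(A_{ijk}(t))$. Then $\alpha$ is a geodesic with respect to the metric $\eta$ if and only if there exists a triple $(i',j',k')\in\mathcal{J}$ such that for all $t,t'\in[0,1]$ with $t\le t'$ we have $$\frac{A_{ijk}(t')}{A_{ijk}(t)}\le\frac{A_{i'j'k'}(t')}{A_{i'j'k'}(t)}\quad\text{for all }(i,j,k)\in\mathcal{J}.$$
   Context: $\mathbb{R}_+^*$ denotes the set of positive reals. Let $S$ be a compact surface, possibly with boundary, and $\mathcal{T}$ a finite triangulation of $S$ with set of edges $E(\mathcal{T})=\{e_i\}$. Fix a set $\mathcal{J}$ of ordered triples $(i,j,k)$ of edge indices such that: (1) for each $(i,j,k)\in\mathcal{J}$, $e_i,e_j,e_k$ are the edges of a face of $\mathcal{T}$; (2) if a face has edges $e_i,e_j,e_k$, some permutation of $(i,j,k)$ is in $\mathcal{J}$; (3) if $(i,j,k)\in\mathcal{J}$, no odd permutation of it is in $\mathcal{J}$; (4) if $(i,j,k)\in\mathcal{J}$, all even permutations of it are in $\mathcal{J}$. $\mathcal{E}(S,\mathcal{T})$ is the set of singular Euclidean metrics $\mu$ on $S$ adapted to $\mathcal{T}$ (each face is a Euclidean triangle; the metric is locally Euclidean except perhaps at the vertices); such $\mu$ is determined by its edge lengths $l_\mu(e_i)>0$, which are arbitrary subject to the strict triangle inequalities for each face. It is identified with its image in $(\mathbb{R}_+^* )^{\mathcal{J}}$ under the injective map $\mu\mapsto(A_{ijk})$,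 $A_{ijk}=\frac{l_\mu(e_j)+l_\mu(e_k)-l_\mu(e_i)}{2}$. This image is the set of $(A_{ijk})\in(\mathbb{R}_+^* )^{\mathcal{J}}$ with $A_{jki}+A_{kij}=A_{j'k'i}+A_{k'ij'}$ whenever $(i,j,k),(i,j',k')\in\mathcal{J}$ with $j\ne j'$, $k\neq k'$ (both sides equal the length of the interior edge $e_i$). $\mathrm{Ar}(A)$ is the area of the singular flat metric corresponding to $A$, i.e. the sum over the faces of $\mathcal{T}$ (with edges $e_i,e_j,e_k$, $(i,j,k)\in\mathcal{J}$) of $\sqrt{(A_{ijk}+A_{jki}+A_{kij})A_{ijk}A_{jki}A_{kij}}$. Set $\mathcal{E}(S,\mathcal{T})_1=\{A\in\mathcal{E}(S,\mathcal{T}):\mathrm{Ar}(A)=1\}$. The (not necessarily symmetric) metric $\eta$ on it is $\eta(A,B)=\log\max_{(i,j,k)\in\mathcal{J}}\frac{B_{ijk}}{A_{ijk}}$, and $\mathcal{E}(S,\mathcal{T})_1$ carries the topology induced by $\max\{\eta(A,B),\eta(B,A)\}$. A continuous path $\alpha:[a,b]\to X$ in a (possibly non-symmetric) metric space $(X,d)$ is a geodesic if $d(\alpha(u),\alpha(w))=d(\alpha(u),\alpha(v))+d(\alpha(v),\alpha(w))$ for all $u\le v\le w$ in $[a,b]$. *)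

theory Defs
  imports "HOL-Analysis.Analysis" "HOL-Homology.Homology" "HOL-Library.Multiset"
begin

section \<open>Triangulated compact surfaces\<close>

text \<open>Surfaces may have boundary (charts in the closed upper half plane); they need be neither
  connected nor orientable.\<close>

definition compact_surface :: "'a topology \<Rightarrow> bool" where
  "compact_surface S \<longleftrightarrow>
     compact_space S \<and> Hausdorff_space S \<and> second_countable S \<and>
     (\<forall>x\<in>topspace S. \<exists>U W. openin S U \<and> x \<in> U \<and>
        openin (top_of_set {z::complex. 0 \<le> Im z}) W \<and>
        subtopology S U homeomorphic_space top_of_set W)"

text \<open>The relatively open face of the standard triangle (in barycentric coordinates) spanned by
  the vertices in \<^term>\<open>K\<close>; for nonempty \<^term>\<open>K\<close> its dimension is \<^term>\<open>card K - 1\<close>.\<close>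

definition open_face :: "nat set \<Rightarrow> (nat \<Rightarrow> real) set" where
  "open_face K = {x \<in> standard_simplex 2. {i. 0 < x i} = K}"

text \<open>A triangulation is given by its faces, one characteristic map from the standard triangle
  for each face.  The open cells (images of the open faces of the standard triangle) partition the
  surface.  As \<^term>\<open>S\<close> is Hausdorff and there are finitely many faces, its topology is the one
  obtained by gluing the triangles.  Every simplicial triangulation is of this form; faces are
  also allowed to share more than one edge.\<close>

definition surface_triangulation :: "'a topology \<Rightarrow> ((nat \<Rightarrow> real) \<Rightarrow> 'a) set \<Rightarrow> bool" where
  "surface_triangulation S T \<longleftrightarrow>
     finite T \<and> (\<forall>\<sigma>\<in>T. singular_simplex 2 S \<sigma>) \<and>
     topspace S = (\<Union>\<sigma>\<in>T. \<sigma> ` standard_simplex 2) \<and>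
     (\<forall>\<sigma>\<in>T. \<forall>K\<subseteq>{..2}. inj_on \<sigma> (open_face K)) \<and>
     (\<forall>\<sigma>\<in>T. \<forall>\<tau>\<in>T. \<forall>K\<subseteq>{..2}. \<forall>L\<subseteq>{..2}.
        \<sigma> ` open_face K \<inter> \<tau> ` open_face L \<noteq> {} \<longrightarrow>
        card K = card L \<and> \<sigma> ` open_face K = \<tau> ` open_face L \<and> (card K = 3 \<longrightarrow> \<sigma> = \<tau>))"

text \<open>Edges are represented by their relative interiors, as subsets of the surface.\<close>

definition side :: "((nat \<Rightarrow> real) \<Rightarrow> 'a) \<Rightarrow> nat \<Rightarrow> 'a set" where
  "side \<sigma> p = \<sigma> ` open_face ({..2} - {p})"

definition edges :: "((nat \<Rightarrow> real) \<Rightarrow> 'a) set \<Rightarrow> 'a set set" where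
  "edges T = {side \<sigma> p | \<sigma> p. \<sigma> \<in> T \<and> p \<le> 2}"

text \<open>The edges indexed by \<^term>\<open>i\<close>, \<^term>\<open>j\<close>, \<^term>\<open>k\<close> are, in some order and
  with multiplicity, the three edges of the face \<^term>\<open>\<sigma>\<close>.\<close>

definition edges_of_face ::
  "('i \<Rightarrow> 'a set) \<Rightarrow> ((nat \<Rightarrow> real) \<Rightarrow> 'a) \<Rightarrow> 'i \<times> 'i \<times> 'i \<Rightarrow> bool" where
  "edges_of_face e \<sigma> = (\<lambda>(i, j, k). {#e i, e j, e k#} = {#side \<sigma> 0, side \<sigma> 1, side \<sigma> 2#})"

definition oriented_triples ::
  "((nat \<Rightarrow> real) \<Rightarrow> 'a) set \<Rightarrow> 'i set \<Rightarrow> ('i \<Rightarrow> 'a set) \<Rightarrow> ('i \<times> 'i \<times> 'i) set \<Rightarrow> bool" where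
  "oriented_triples T I e J \<longleftrightarrow>
     J \<subseteq> I \<times> I \<times> I \<and>
     (\<forall>t\<in>J. \<exists>\<sigma>\<in>T. edges_of_face e \<sigma> t) \<and>
     (\<forall>\<sigma>\<in>T. \<forall>i\<in>I. \<forall>j\<in>I. \<forall>k\<in>I. edges_of_face e \<sigma> (i, j, k) \<longrightarrow>
        {(i, j, k), (j, k, i), (k, i, j), (j, i, k), (i, k, j), (k, j, i)} \<inter> J \<noteq> {}) \<and>
     (\<forall>i j k. (i, j, k) \<in> J \<longrightarrow> (j, i, k) \<notin> J \<and> (i, k, j) \<notin> J \<and> (k, j, i) \<notin> J) \<and>
     (\<forall>i j k. (i, j, k) \<in> J \<longrightarrow> (j, k, i) \<in> J \<and> (k, i, j) \<in> J)"


section \<open>Singular Euclidean metrics adapted to a triangulation\<close>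

text \<open>A singular Euclidean metric adapted to the triangulation is given by its edge lengths.  The
  set \<^term>\<open>J\<close> is closed under even permutations, so the condition below comprises all three
  strict triangle inequalities of every face.\<close>

definition edge_lengths :: "'i set \<Rightarrow> ('i \<times> 'i \<times> 'i) set \<Rightarrow> ('i \<Rightarrow> real) set" where
  "edge_lengths I J = {l \<in> I \<rightarrow>\<^sub>E {0<..}. \<forall>(i, j, k)\<in>J. l i < l j + l k}"

definition A_coords ::
  "('i \<times> 'i \<times> 'i) set \<Rightarrow> ('i \<Rightarrow> real) \<Rightarrow> 'i \<times> 'i \<times> 'i \<Rightarrow> real" where
  "A_coords J l = (\<lambda>(i, j, k)\<in>J. (l j + l k - l i) / 2)"

definition sing_metrics :: "'i set \<Rightarrow> ('i \<times> 'i \<times> 'i) set \<Rightarrow> ('i \<times> 'i \<times> 'i \<Rightarrow> real) set" where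
  "sing_metrics I J = A_coords J ` edge_lengths I J"

text \<open>The choice of the triple below is immaterial, see \<open>face_area_eq\<close>.\<close>

definition face_area ::
  "('i \<Rightarrow> 'a set) \<Rightarrow> ('i \<times> 'i \<times> 'i) set \<Rightarrow> ('i \<times> 'i \<times> 'i \<Rightarrow> real) \<Rightarrow> ((nat \<Rightarrow> real) \<Rightarrow> 'a) \<Rightarrow> real"
  where
  "face_area e J A \<sigma> =
     (let (i, j, k) = (SOME t. t \<in> J \<and> edges_of_face e \<sigma> t) in
      sqrt ((A (i, j, k) + A (j, k, i) + A (k, i, j)) * A (i, j, k) * A (j, k, i) * A (k, i, j)))"

definition area ::
  "((nat \<Rightarrow> real) \<Rightarrow> 'a) set \<Rightarrow> ('i \<Rightarrow> 'a set) \<Rightarrow> ('i \<times> 'i \<times> 'i) set \<Rightarrow>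
   ('i \<times> 'i \<times> 'i \<Rightarrow> real) \<Rightarrow> real" where
  "area T e J A = (\<Sum>\<sigma>\<in>T. face_area e J A \<sigma>)"

definition sing_metrics_1 ::
  "((nat \<Rightarrow> real) \<Rightarrow> 'a) set \<Rightarrow> 'i set \<Rightarrow> ('i \<Rightarrow> 'a set) \<Rightarrow> ('i \<times> 'i \<times> 'i) set \<Rightarrow>
   ('i \<times> 'i \<times> 'i \<Rightarrow> real) set" where
  "sing_metrics_1 T I e J = {A \<in> sing_metrics I J. area T e J A = 1}"

definition eta ::
  "('i \<times> 'i \<times> 'i) set \<Rightarrow> ('i \<times> 'i \<times> 'i \<Rightarrow> real) \<Rightarrow> ('i \<times> 'i \<times> 'i \<Rightarrow> real) \<Rightarrow> real" where
  "eta J A B = ln (MAX t\<in>J. B t / A t)"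


section \<open>Geodesics in non-symmetric metric spaces\<close>

text \<open>The value outside \<^term>\<open>X\<close> is irrelevant; it is fixed so that the library locale
  \<^locale>\<open>Metric_space\<close>, which demands nonnegativity and symmetry everywhere, applies.\<close>

definition sym_dist :: "'x set \<Rightarrow> ('x \<Rightarrow> 'x \<Rightarrow> real) \<Rightarrow> 'x \<Rightarrow> 'x \<Rightarrow> real" where
  "sym_dist X d x y = (if x \<in> X \<and> y \<in> X then max (d x y) (d y x) else 0)"

definition continuous_path ::
  "'x set \<Rightarrow> ('x \<Rightarrow> 'x \<Rightarrow> real) \<Rightarrow> real \<Rightarrow> real \<Rightarrow> (real \<Rightarrow> 'x) \<Rightarrow> bool" where
  "continuous_path X d a b \<alpha> \<longleftrightarrow>
     continuous_map (top_of_set {a..b}) (Metric_space.mtopology X (sym_dist X d)) \<alpha>"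

definition geodesic ::
  "'x set \<Rightarrow> ('x \<Rightarrow> 'x \<Rightarrow> real) \<Rightarrow> real \<Rightarrow> real \<Rightarrow> (real \<Rightarrow> 'x) \<Rightarrow> bool" where
  "geodesic X d a b \<alpha> \<longleftrightarrow>
     continuous_path X d a b \<alpha> \<and>
     (\<forall>u v w. a \<le> u \<and> u \<le> v \<and> v \<le> w \<and> w \<le> b \<longrightarrow>
        d (\<alpha> u) (\<alpha> w) = d (\<alpha> u) (\<alpha> v) + d (\<alpha> v) (\<alpha> w))"


section \<open>Consistency of the definitions\<close>

lemma oriented_triplesD:
  assumes "oriented_triples T I e J"
  shows "J \<subseteq> I \<times> I \<times> I"
    and "\<And>\<sigma> i j k. \<sigma> \<in> T \<Longrightarrow> i \<in> I \<Longrightarrow> j \<in> I \<Longrightarrow> k \<in> I \<Longrightarrow> edges_of_face e \<sigma> (i, j, k) \<Longrightarrow>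
      {(i, j, k), (j, k, i), (k, i, j), (j, i, k), (i, k, j), (k, j, i)} \<inter> J \<noteq> {}"
    and "\<And>i j k. (i, j, k) \<in> J \<Longrightarrow> (j, i, k) \<notin> J \<and> (i, k, j) \<notin> J \<and> (k, j, i) \<notin> J"
    and "\<And>i j k. (i, j, k) \<in> J \<Longrightarrow> (j, k, i) \<in> J \<and> (k, i, j) \<in> J"
proof -
  note d = assms[unfolded oriented_triples_def]
  show "J \<subseteq> I \<times> I \<times> I" using d by (elim conjE)
  show "{(i, j, k), (j, k, i), (k, i, j), (j, i, k), (i, k, j), (k, j, i)} \<inter> J \<noteq> {}"
    if "\<sigma> \<in> T" "i \<in> I" "j \<in> I" "k \<in> I" "edges_of_face e \<sigma> (i, j, k)" for \<sigma> i j k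
    using d[THEN conjunct2, THEN conjunct2, THEN conjunct1, rule_format, OF that] .
  show "(j, i, k) \<notin> J \<and> (i, k, j) \<notin> J \<and> (k, j, i) \<notin> J" if "(i, j, k) \<in> J" for i j k
    using d[THEN conjunct2, THEN conjunct2, THEN conjunct2, THEN conjunct1, rule_format, OF that]
    by blast
  show "(j, k, i) \<in> J \<and> (k, i, j) \<in> J" if "(i, j, k) \<in> J" for i j k
    using d[THEN conjunct2, THEN conjunct2, THEN conjunct2, THEN conjunct2, rule_format, OF that]
    by blast
qed

lemma triple_edges_distinct:
  assumes "oriented_triples T I e J" "(i, j, k) \<in> J"
  shows "i \<noteq> j" "j \<noteq> k" "i \<noteq> k"
  using oriented_triplesD(3)[OF assms] assms(2) by auto

lemma finite_triples:
  assumes "surface_triangulation S T" "bij_betw e I (edges T)" "oriented_triples T I e J"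
  shows "finite J"
proof -
  have "finite T" using assms(1) by (simp add: surface_triangulation_def)
  moreover have "edges T = (\<lambda>(\<sigma>, p). side \<sigma> p) ` (T \<times> {..2})"
    by (auto simp: edges_def)
  ultimately have "finite (edges T)" by simp
  then have "finite I" using assms(2) bij_betw_finite by blast
  then show ?thesis
    using oriented_triplesD(1)[OF assms(3)] by (meson finite_SigmaI finite_subset)
qed

lemma face_area_eq:
  assumes "bij_betw e I (edges T)" "oriented_triples T I e J"
    and t: "(i, j, k) \<in> J" "edges_of_face e \<sigma> (i, j, k)"
  shows "face_area e J A \<sigma> =
    sqrt ((A (i, j, k) + A (j, k, i) + A (k, i, j)) * A (i, j, k) * A (j, k, i) * A (k, i, j))"
proof -
  obtain x y z where xyz: "(SOME t. t \<in> J \<and> edges_of_face e \<sigma> t) = (x, y, z)"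
    by (metis prod_cases3)
  have s: "(x, y, z) \<in> J" "edges_of_face e \<sigma> (x, y, z)"
    using someI[of "\<lambda>t. t \<in> J \<and> edges_of_face e \<sigma> t" "(i, j, k)"] t xyz by auto
  have inI: "{x, y, z, i, j, k} \<subseteq> I"
    using s(1) t(1) oriented_triplesD(1)[OF assms(2)] by auto
  have inj: "inj_on e I" using assms(1) by (simp add: bij_betw_def)
  have "image_mset e {#x, y, z#} = image_mset e {#i, j, k#}"
    using s(2) t(2) by (simp add: edges_of_face_def)
  from arg_cong[OF this, of set_mset] have "e ` {x, y, z} = e ` {i, j, k}" by simp
  then have eq: "{x, y, z} = {i, j, k}"
    using inj_on_image_eq_iff[OF inj, of "{x, y, z}" "{i, j, k}"] inI by blast
  have "(x, y, z) \<in> {(i, j, k), (j, k, i), (k, i, j), (j, i, k), (i, k, j), (k, j, i)}"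
  proof -
    have "x \<in> {i, j, k}" "y \<in> {i, j, k}" "z \<in> {i, j, k}" using eq by blast+
    then show ?thesis
      using triple_edges_distinct[OF assms(2) s(1)] by (elim insertE emptyE) simp_all
  qed
  then have "(x, y, z) \<in> {(i, j, k), (j, k, i), (k, i, j)}"
    using s(1) oriented_triplesD(3)[OF assms(2) t(1)] by auto
  then show ?thesis
    unfolding face_area_def xyz by (elim insertE emptyE) (simp_all add: ac_simps)
qed

text \<open>If distinct faces share at most one edge, as in a simplicial complex, then the image
  is described by the compatibility of the lengths of the interior edges.\<close>

lemma sing_metrics_eq:
  assumes e: "bij_betw e I (edges T)" and J: "oriented_triples T I e J"
    and one: "\<And>i j k j' k'. (i, j, k) \<in> J \<Longrightarrow> (i, j', k') \<in> J \<Longrightarrow> j = j' \<longleftrightarrow> k = k'"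
  shows "sing_metrics I J =
    {A \<in> J \<rightarrow>\<^sub>E {0<..}. \<forall>i j k j' k'. (i, j, k) \<in> J \<and> (i, j', k') \<in> J \<and> j \<noteq> j' \<and> k \<noteq> k' \<longrightarrow>
       A (j, k, i) + A (k, i, j) = A (j', k', i) + A (k', i, j')}" (is "_ = ?R")
proof
  have cyc: "(j, k, i) \<in> J" "(k, i, j) \<in> J" if "(i, j, k) \<in> J" for i j k
    using oriented_triplesD(4)[OF J that] by auto
  have sub: "J \<subseteq> I \<times> I \<times> I" using oriented_triplesD(1)[OF J] .
  show "sing_metrics I J \<subseteq> ?R"
  proof
    fix A assume "A \<in> sing_metrics I J"
    then obtain l where l: "l \<in> edge_lengths I J" and A: "A = A_coords J l"
      by (auto simp: sing_metrics_def)
    have "A \<in> J \<rightarrow>\<^sub>E {0<..}"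
      using l unfolding A A_coords_def edge_lengths_def by auto
    moreover have "A (j, k, i) + A (k, i, j) = l i" if "(i, j, k) \<in> J" for i j k
      using cyc[OF that] unfolding A A_coords_def by (simp add: field_simps)
    ultimately show "A \<in> ?R" by auto
  qed
  show "?R \<subseteq> sing_metrics I J"
  proof
    fix A assume A: "A \<in> ?R"
    have pos: "0 < A t" if "t \<in> J" for t using A that by (auto simp: PiE_iff)
    have ex: "\<exists>j k. (i, j, k) \<in> J" if i: "i \<in> I" for i
    proof -
      have "e i \<in> edges T" using e i by (auto simp: bij_betw_def)
      then obtain \<sigma> p where \<sigma>: "\<sigma> \<in> T" and p: "p \<le> 2" "e i = side \<sigma> p"
        unfolding edges_def by blast
      have "\<exists>x\<in>I. e x = side \<sigma> q" if "q \<le> 2" for q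
      proof -
        have "side \<sigma> q \<in> e ` I"
          using e \<sigma> that unfolding edges_def bij_betw_def by blast
        then show ?thesis by auto
      qed
      then obtain f where f: "\<And>q. q \<le> 2 \<Longrightarrow> f q \<in> I \<and> e (f q) = side \<sigma> q" by metis
      have "edges_of_face e \<sigma> (f 0, f 1, f 2)"
        using f by (simp add: edges_of_face_def)
      then have ne: "{(f 0, f 1, f 2), (f 1, f 2, f 0), (f 2, f 0, f 1),
          (f 1, f 0, f 2), (f 0, f 2, f 1), (f 2, f 1, f 0)} \<inter> J \<noteq> {}"
        using f by (intro oriented_triplesD(2)[OF J \<sigma>]) auto
      have ifp: "i = f p"
        using e i f p unfolding bij_betw_def by (metis inj_on_eq_iff)
      have "p = 0 \<or> p = 1 \<or> p = 2" using p(1) by auto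
      then show ?thesis unfolding ifp using ne by (auto dest: cyc)
    qed
    then obtain g h where gh: "\<And>i. i \<in> I \<Longrightarrow> (i, g i, h i) \<in> J" by metis
    define l where "l = (\<lambda>i\<in>I. A (g i, h i, i) + A (h i, i, g i))"
    have l: "l i = A (j, k, i) + A (k, i, j)" if t: "(i, j, k) \<in> J" for i j k
    proof -
      have i: "i \<in> I" using t sub by blast
      show ?thesis
      proof (cases "g i = j")
        case True
        then have "h i = k" using one[OF gh[OF i] t] by simp
        then show ?thesis using True i by (simp add: l_def)
      next
        case False
        then have "h i \<noteq> k" using one[OF gh[OF i] t] by simp
        then show ?thesis using A False gh[OF i] t i by (simp add: l_def)
      qed
    qed
    have l2: "(l j + l k - l i) / 2 = A (i, j, k)" if "(i, j, k) \<in> J" for i j k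
      using l[OF that] l[OF cyc(1)[OF that]] l[OF cyc(2)[OF that]] by simp
    have "0 < l i" if "i \<in> I" for i
      using that pos[OF cyc(1)[OF gh[OF that]]] pos[OF cyc(2)[OF gh[OF that]]] by (simp add: l_def)
    then have "l \<in> I \<rightarrow>\<^sub>E {0<..}" by (auto simp: l_def)
    moreover have "l i < l j + l k" if "(i, j, k) \<in> J" for i j k
      using l2[OF that] pos[OF that] by simp
    ultimately have "l \<in> edge_lengths I J" by (auto simp: edge_lengths_def)
    moreover have "A = A_coords J l"
    proof
      fix t show "A t = A_coords J l t"
      proof (cases "t \<in> J")
        case True then show ?thesis by (cases t) (auto simp: A_coords_def l2)
      next
        case False
        moreover have "A \<in> J \<rightarrow>\<^sub>E {0<..}" using A by blast
        ultimately show ?thesis using PiE_arb[of A J "\<lambda>_. {0<..}" t] by (simp add: A_coords_def)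
      qed
    qed
    ultimately show "A \<in> sing_metrics I J" by (auto simp: sing_metrics_def)
  qed
qed

lemma Metric_space_sing_metrics_1:
  assumes "surface_triangulation S T" "bij_betw e I (edges T)" "oriented_triples T I e J"
  shows "Metric_space (sing_metrics_1 T I e J) (sym_dist (sing_metrics_1 T I e J) (eta J))"
proof (cases "J = {}")
  case True
  have "T = {}"
  proof (rule ccontr)
    assume "T \<noteq> {}"
    then obtain \<sigma> where \<sigma>: "\<sigma> \<in> T" by blast
    have "\<exists>x\<in>I. e x = side \<sigma> q" if "q \<le> 2" for q
    proof -
      have "side \<sigma> q \<in> e ` I"
        using assms(2) \<sigma> that unfolding edges_def bij_betw_def by blast
      then show ?thesis by auto
    qed
    then obtain f where f: "\<And>q. q \<le> 2 \<Longrightarrow> f q \<in> I \<and> e (f q) = side \<sigma> q" by metis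
    have "edges_of_face e \<sigma> (f 0, f 1, f 2)"
      using f by (simp add: edges_of_face_def)
    then show False
      using oriented_triplesD(2)[OF assms(3) \<sigma>, of "f 0" "f 1" "f 2"] f True by simp
  qed
  then have "sing_metrics_1 T I e J = {}" by (simp add: sing_metrics_1_def area_def)
  then show ?thesis by unfold_locales (auto simp: sym_dist_def)
next
  case False
  let ?X = "sing_metrics_1 T I e J"
  have fin: "finite J" using finite_triples[OF assms] .
  have pos: "0 < A t" if "A \<in> ?X" "t \<in> J" for A t
    using that by (auto simp: sing_metrics_1_def sing_metrics_def A_coords_def edge_lengths_def)
  have ext: "A t = undefined" if "A \<in> ?X" "t \<notin> J" for A t
    using that by (auto simp: sing_metrics_1_def sing_metrics_def A_coords_def)
  define m where "m A B = (MAX t\<in>J. B t / A t)" for A B :: "'b \<times> 'b \<times> 'b \<Rightarrow> real"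
  have eta: "eta J A B = ln (m A B)" for A B by (simp add: eta_def m_def)
  have mge: "B t / A t \<le> m A B" if "t \<in> J" for A B t
    unfolding m_def using fin that by (intro Max_ge) auto
  have mle: "m A B \<le> c" if "\<And>t. t \<in> J \<Longrightarrow> B t / A t \<le> c" for A B c
    unfolding m_def using fin False that by (subst Max_le_iff) auto
  have mpos: "0 < m A B" if "A \<in> ?X" "B \<in> ?X" for A B
  proof -
    obtain t where "t \<in> J" using False by blast
    then show ?thesis using mge[of t B A] pos that by (smt (verit) divide_pos_pos)
  qed
  have leD: "B t \<le> A t" if "eta J A B \<le> 0" "A \<in> ?X" "B \<in> ?X" "t \<in> J" for A B t
  proof -
    have "m A B \<le> 1" using that mpos[OF that(2,3)] by (simp add: eta)
    then have "B t / A t \<le> 1" using mge[OF that(4), of B A] by linarith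
    then show ?thesis using pos[OF that(2,4)] by simp
  qed
  have diag: "eta J A A = 0" if "A \<in> ?X" for A
  proof -
    have "A t / A t = 1" if "t \<in> J" for t using pos[OF \<open>A \<in> ?X\<close> that] by simp
    then have "(\<lambda>t. A t / A t) ` J = {1}" using False by force
    then show ?thesis by (simp add: eta_def)
  qed
  have tri: "eta J A C \<le> eta J A B + eta J B C" if X: "A \<in> ?X" "B \<in> ?X" "C \<in> ?X" for A B C
  proof -
    have "C t / A t \<le> m A B * m B C" if t: "t \<in> J" for t
    proof -
      have "C t / A t = (B t / A t) * (C t / B t)" using pos[OF X(2) t] by simp
      also have "\<dots> \<le> m A B * m B C"
        using mge[OF t] mpos[OF X(1,2)] pos[OF _ t] X
        by (intro mult_mono) (auto intro: less_imp_le)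
      finally show ?thesis .
    qed
    then have "m A C \<le> m A B * m B C" by (rule mle)
    then have "ln (m A C) \<le> ln (m A B * m B C)"
      using mpos X by (simp add: zero_less_mult_iff)
    also have "\<dots> = ln (m A B) + ln (m B C)"
      using mpos[OF X(1,2)] mpos[OF X(2,3)] by (simp add: ln_mult)
    finally show ?thesis by (simp add: eta)
  qed
  have nn: "0 \<le> max (eta J A B) (eta J B A)" if "A \<in> ?X" "B \<in> ?X" for A B
    using tri[of A B A] diag that by fastforce
  show ?thesis
  proof
    fix A B
    show "0 \<le> sym_dist ?X (eta J) A B" using nn by (auto simp: sym_dist_def)
    show "sym_dist ?X (eta J) A B = sym_dist ?X (eta J) B A" by (auto simp: sym_dist_def)
    show "sym_dist ?X (eta J) A B = 0 \<longleftrightarrow> A = B" if X: "A \<in> ?X" "B \<in> ?X"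
    proof
      assume "sym_dist ?X (eta J) A B = 0"
      then have le: "eta J A B \<le> 0" "eta J B A \<le> 0" using X by (auto simp: sym_dist_def max_def split: if_splits)
      show "A = B"
      proof
        fix t show "A t = B t"
        proof (cases "t \<in> J")
          case True
          then show ?thesis using leD[OF le(1) X True] leD[OF le(2) X(2,1) True] by simp
        next
          case False
          then show ?thesis using ext[OF X(1) False] ext[OF X(2) False] by simp
        qed
      qed
    qed (use X diag in \<open>simp add: sym_dist_def\<close>)
  next
    fix A B C assume X: "A \<in> ?X" "B \<in> ?X" "C \<in> ?X"
    show "sym_dist ?X (eta J) A C \<le> sym_dist ?X (eta J) A B + sym_dist ?X (eta J) B C"
      using tri[OF X] tri[OF X(3,2,1)] X by (auto simp: sym_dist_def)
  qed
qed

end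

(* Since the maximum of the products of ratios along u <= v <= w is at most the product of the maxima,
   additivity of eta forces a triple attaining the maximum for (u, w) to attain it for (u, v) and (v, w)
   as well.  So a triple attaining the maximum between the endpoints attains it on every
   subinterval.  Conversely, for a fixed triple the logarithms of the ratios add up. *)

theory Submission
  imports Defs
begin

lemma sing_metrics_1_pos:
  assumes "A \<in> sing_metrics_1 T I e J" "t \<in> J"
  shows "0 < A t"
  using assms by (auto simp: sing_metrics_1_def sing_metrics_def A_coords_def edge_lengths_def)

text \<open>The maximum in \<open>eta\<close> is attained only over a nonempty index set. A metric
  of area 1 forces a face to exist; \<open>e\<close> indexes its three sides, and some ordering of
  these indices lies in \<open>J\<close>.\<close>

lemma triples_nonempty:
  assumes "bij_betw e I (edges T)" "oriented_triples T I e J" "sing_metrics_1 T I e J \<noteq> {}"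
  shows "J \<noteq> {}"
proof -
  \<comment> \<open>Without faces the area would be an empty sum, 0 instead of 1.\<close>
  have "T \<noteq> {}" using assms(3) by (auto simp: sing_metrics_1_def area_def)
  then obtain \<sigma> where \<sigma>: "\<sigma> \<in> T" by blast
  have "\<exists>x\<in>I. e x = side \<sigma> q" if "q \<le> 2" for q
  proof -
    have "side \<sigma> q \<in> e ` I" using assms(1) \<sigma> that unfolding edges_def bij_betw_def by blast
    then show ?thesis by auto
  qed
  then obtain f where f: "\<And>q. q \<le> 2 \<Longrightarrow> f q \<in> I \<and> e (f q) = side \<sigma> q" by metis
  then have "edges_of_face e \<sigma> (f 0, f 1, f 2)" by (simp add: edges_of_face_def)
  then show ?thesis using oriented_triplesD(2)[OF assms(2) \<sigma>, of "f 0" "f 1" "f 2"] f by auto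
qed

lemma eta_attained:
  assumes "finite J" "J \<noteq> {}"
  obtains s where "s \<in> J" "eta J A B = ln (B s / A s)"
proof -
  have "(MAX t\<in>J. B t / A t) \<in> (\<lambda>t. B t / A t) ` J" using assms by (intro Max_in) auto
  then show ?thesis using that by (auto simp: eta_def)
qed

lemma ln_ratio_le_eta:
  assumes "finite J" "t \<in> J" "0 < A t" "0 < B t"
  shows "ln (B t / A t) \<le> eta J A B"
proof -
  have "B t / A t \<le> (MAX t\<in>J. B t / A t)" using assms by (intro Max_ge) auto
  moreover have "0 < B t / A t" using assms by simp
  ultimately show ?thesis unfolding eta_def by (intro ln_mono) auto
qed

lemma eta_eqI:
  assumes "finite J" "s \<in> J" "\<And>t. t \<in> J \<Longrightarrow> B t / A t \<le> B s / A s"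
  shows "eta J A B = ln (B s / A s)"
proof -
  have "(MAX t\<in>J. B t / A t) = B s / A s" using assms by (intro Max_eqI) auto
  then show ?thesis by (simp add: eta_def)
qed

text \<open>Isolates the part of the argument that concerns only families of positive functions on a
  finite index set, apart from the surface and the topology.\<close>

lemma eta_additive_iff:
  fixes \<alpha> :: "real \<Rightarrow> 'i \<times> 'i \<times> 'i \<Rightarrow> real"
  assumes fin: "finite J" and ne: "J \<noteq> {}" and "a \<le> b"
    and pos: "\<And>u t. u \<in> {a..b} \<Longrightarrow> t \<in> J \<Longrightarrow> 0 < \<alpha> u t"
  shows "(\<forall>u v w. a \<le> u \<and> u \<le> v \<and> v \<le> w \<and> w \<le> b \<longrightarrow>
      eta J (\<alpha> u) (\<alpha> w) = eta J (\<alpha> u) (\<alpha> v) + eta J (\<alpha> v) (\<alpha> w)) \<longleftrightarrow>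
    (\<exists>s\<in>J. \<forall>u\<in>{a..b}. \<forall>w\<in>{a..b}. u \<le> w \<longrightarrow> (\<forall>t\<in>J. \<alpha> w t / \<alpha> u t \<le> \<alpha> w s / \<alpha> u s))"
    (is "?add \<longleftrightarrow> ?max")
proof
  assume add: ?add
  \<comment> \<open>The triple is chosen from the endpoints alone, hence before \<open>u\<close> and
    \<open>w\<close>; this gives one \<open>s\<close> for all subintervals.\<close>
  obtain s where s: "s \<in> J" "eta J (\<alpha> a) (\<alpha> b) = ln (\<alpha> b s / \<alpha> a s)"
    using eta_attained[OF fin ne] .
  have "\<alpha> w t / \<alpha> u t \<le> \<alpha> w s / \<alpha> u s"
    if uw: "u \<in> {a..b}" "w \<in> {a..b}" "u \<le> w" and t: "t \<in> J" for u w t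
  proof -
    have ab: "a \<in> {a..b}" "b \<in> {a..b}" using \<open>a \<le> b\<close> by auto
    note p = pos[OF ab(1) s(1)] pos[OF ab(2) s(1)] pos[OF uw(1) s(1)] pos[OF uw(2) s(1)]
      pos[OF uw(1) t] pos[OF uw(2) t]
    \<comment> \<open>Cutting at \<open>u\<close> and then at \<open>w\<close> splits the total into
      three terms.\<close>
    have "eta J (\<alpha> a) (\<alpha> b) = eta J (\<alpha> a) (\<alpha> u) + eta J (\<alpha> u) (\<alpha> b)"
      "eta J (\<alpha> u) (\<alpha> b) = eta J (\<alpha> u) (\<alpha> w) + eta J (\<alpha> w) (\<alpha> b)"
      using add[rule_format, of a u b] add[rule_format, of u w b] uw by simp_all
    moreover have "ln (\<alpha> u s / \<alpha> a s) \<le> eta J (\<alpha> a) (\<alpha> u)" "ln (\<alpha> b s / \<alpha> w s) \<le> eta J (\<alpha> w) (\<alpha> b)"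
      "ln (\<alpha> w t / \<alpha> u t) \<le> eta J (\<alpha> u) (\<alpha> w)"
      using p s(1) t by (simp_all add: ln_ratio_le_eta[OF fin])
    \<comment> \<open>The total is \<open>ln (\<alpha> b s / \<alpha> a s)\<close>, which telescopes
      over the same three pieces. Since the two outer terms are at least their
      \<open>s\<close>-logarithms, the middle one is at most
      \<open>ln (\<alpha> w s / \<alpha> u s)\<close>.\<close>
    ultimately have "ln (\<alpha> w t / \<alpha> u t) \<le> ln (\<alpha> w s / \<alpha> u s)"
      using s(2) p by (simp add: ln_div)
    then show ?thesis using p by (subst (asm) ln_le_cancel_iff) auto
  qed
  then show ?max using s(1) by blast
next
  assume ?max
  then obtain s where s: "s \<in> J"
    and max: "\<And>u w t. u \<in> {a..b} \<Longrightarrow> w \<in> {a..b} \<Longrightarrow> u \<le> w \<Longrightarrow> t \<in> J \<Longrightarrow>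
      \<alpha> w t / \<alpha> u t \<le> \<alpha> w s / \<alpha> u s"
    by blast
  \<comment> \<open>With \<open>s\<close> fixed, \<open>eta\<close> along the path is the increment
    of a single real function, so additivity is immediate.\<close>
  have "eta J (\<alpha> u) (\<alpha> w) = ln (\<alpha> w s) - ln (\<alpha> u s)" if "a \<le> u" "u \<le> w" "w \<le> b" for u w
    using eta_eqI[OF fin s, of "\<alpha> w" "\<alpha> u"] max[of u w] pos[of u s] pos[of w s] s that by (simp add: ln_div)
  then show ?add by simp
qed

theorem theorem4p5:
  fixes S :: "'a topology" and T :: "((nat \<Rightarrow> real) \<Rightarrow> 'a) set"
    and I :: "'i set" and e :: "'i \<Rightarrow> 'a set" and J :: "('i \<times> 'i \<times> 'i) set"
    and \<alpha> :: "real \<Rightarrow> 'i \<times> 'i \<times> 'i \<Rightarrow> real"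
  assumes "compact_surface S" and "surface_triangulation S T"
    and "bij_betw e I (edges T)" and "oriented_triples T I e J"
    and "continuous_path (sing_metrics_1 T I e J) (eta J) 0 1 \<alpha>"
  shows "geodesic (sing_metrics_1 T I e J) (eta J) 0 1 \<alpha> \<longleftrightarrow>
    (\<exists>(i', j', k')\<in>J. \<forall>t\<in>{0..1}. \<forall>t'\<in>{0..1}. t \<le> t' \<longrightarrow>
       (\<forall>(i, j, k)\<in>J. \<alpha> t' (i, j, k) / \<alpha> t (i, j, k) \<le> \<alpha> t' (i', j', k') / \<alpha> t (i', j', k')))"
proof -
  let ?X = "sing_metrics_1 T I e J"
  \<comment> \<open>This identifies the underlying set of the metric topology with
    \<open>?X\<close>, so continuity places the values of the path in \<open>?X\<close>.\<close>
  interpret Metric_space ?X "sym_dist ?X (eta J)"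
    using Metric_space_sing_metrics_1[OF assms(2,3,4)] .
  have X: "\<alpha> u \<in> ?X" if "u \<in> {0..1}" for u
    using assms(5) that by (auto simp: continuous_path_def continuous_map_def)
  have "?X \<noteq> {}" using X[of 0] by force
  then have "J \<noteq> {}" using triples_nonempty[OF assms(3,4)] by blast
  then have "geodesic ?X (eta J) 0 1 \<alpha> \<longleftrightarrow> (\<exists>s\<in>J. \<forall>u\<in>{0..1}. \<forall>w\<in>{0..1}. u \<le> w \<longrightarrow>
      (\<forall>t\<in>J. \<alpha> w t / \<alpha> u t \<le> \<alpha> w s / \<alpha> u s))"
    using eta_additive_iff[OF finite_triples[OF assms(2,3,4)], of 0 1 \<alpha>]
      sing_metrics_1_pos[OF X] assms(5)
    by (simp add: geodesic_def)
  then show ?thesis by (simp add: split_beta)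
qed

end
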